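(* Let $H$ and $\tilde H$ be two reproducing kernel Hilbert spaces of continuously differentiable real-valued functions on $\mathbb{R}^n$, and let $f : \mathbb{R}^n \to \mathbb{R}^n$ be such that the Liouville operator $A_f g(x) = \nabla g(x) f(x)$ is well defined and compact as an operator from $H$ to $\tilde H$. Let $\{\varphi_m\}_{m=0}^\infty$ be an orthonormal basis of $H$ consisting of eigenfunctions of $A_f^* A_f$, with $A_f^* A_f \varphi_m = \sigma_m^2 \varphi_m$ and $\sigma_m \ge 0$, and for each $m$ with $\sigma_m \neq 0$ set $\psi_m := A_f \varphi_m / \sigma_m$. Assume that each coordinate function $x \mapsto (x)_i$, $i = 1,\ldots,n$, belongs to $H$, and let $\xi_m \in \mathbb{R}^n$ be the vector with entries $(\xi_m)_i = \langle (x)_i, \varphi_m \rangle_H$. Then $\{\psi_m : \sigma_m \ne 0\}$ is an orthonormal set in $\tilde H$; for each $i$, $(x)_i = \sum_{m=0}^\infty (\xi_m)_i \varphi_m(x)$; and for every trajectory $x : [0,T] \to \mathbb{R}^n$ satisfying $\dot x(t) = f(x(t))$, we have for all $t \in [0,T]$ $$\dot x(t) = \sum_{\sigma_m \neq 0} \xi_m \sigma_m \psi_m(x(t)) \quad\text{and}\quad x(t) = x(0) + \sum_{\sigma_m \neq 0} \xi_m \sigma_m \int_0^t \psi_m(x(\tau))\, d\tau .$$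
   Context: A reproducing kernel Hilbert space over a set $X$ is a Hilbert space of functions $X \to \mathbb{R}$ on which every point evaluation $g \mapsto g(x)$ is bounded. $(x)_i$ denotes the $i$-th component of $x \in \mathbb{R}^n$, regarded as a function of $x$. $\nabla g(x)$ is a row vector, so $\nabla g(x) f(x) = \sum_i \frac{\partial g}{\partial x_i}(x) f_i(x)$. $A_f^* : \tilde H \to H$ is the Hilbert space adjoint. *)

theory Defs
  imports "HOL-Analysis.Analysis"
begin

(* A reproducing kernel Hilbert space over 'x is modelled by a Hilbert space type 'h
   together with ev :: 'h => 'x => real, where ev g is the function that the vector g is.
   Injectivity of ev says that a vector is determined by its function; linearity of
   each point evaluation says that the vector space operations are the pointwise ones. *)
definition rkhs :: "('h::{real_inner,complete_space} \<Rightarrow> 'x \<Rightarrow> real) \<Rightarrow> bool" where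
  "rkhs ev \<longleftrightarrow> inj ev \<and> (\<forall>x. bounded_linear (\<lambda>g. ev g x))"

definition continuously_differentiable :: "(real ^ 'n \<Rightarrow> real) \<Rightarrow> bool" where
  "continuously_differentiable g \<longleftrightarrow>
     (\<exists>G. (\<forall>x. GDERIV g x :> G x) \<and> continuous_on UNIV G)"

definition partial_deriv :: "'n \<Rightarrow> (real ^ 'n \<Rightarrow> real) \<Rightarrow> real ^ 'n \<Rightarrow> real" where
  "partial_deriv i g x = deriv (\<lambda>s. g (x + s *\<^sub>R axis i 1)) 0"

definition liouville :: "(real ^ 'n \<Rightarrow> real ^ 'n) \<Rightarrow> (real ^ 'n \<Rightarrow> real) \<Rightarrow> real ^ 'n \<Rightarrow> real" where
  "liouville f g x = (\<Sum>i\<in>UNIV. partial_deriv i g x * f x $ i)"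

definition compact_operator :: "('h::real_normed_vector \<Rightarrow> 'k::real_normed_vector) \<Rightarrow> bool" where
  "compact_operator A \<longleftrightarrow> linear A \<and> (\<forall>S. bounded S \<longrightarrow> compact (closure (A ` S)))"

definition orthonormal_on :: "'i set \<Rightarrow> ('i \<Rightarrow> 'h::real_inner) \<Rightarrow> bool" where
  "orthonormal_on I e \<longleftrightarrow> (\<forall>i\<in>I. \<forall>j\<in>I. e i \<bullet> e j = (if i = j then 1 else 0))"

definition orthonormal_basis :: "(nat \<Rightarrow> 'h::real_inner) \<Rightarrow> bool" where
  "orthonormal_basis e \<longleftrightarrow> orthonormal_on UNIV e \<and> closure (span (range e)) = UNIV"

(* One-sided derivatives at the end points; 0 < T makes the derivative at 0 meaningful. *)
definition trajectory :: "(real ^ 'n \<Rightarrow> real ^ 'n) \<Rightarrow> real \<Rightarrow> (real \<Rightarrow> real ^ 'n) \<Rightarrow> bool" where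
  "trajectory f T x \<longleftrightarrow>
     0 < T \<and> (\<forall>t\<in>{0..T}. (x has_vector_derivative f (x t)) (at t within {0..T}))"

end

theory Submission
  imports Defs
begin

text \<open>
  The operator \<open>A\<close> has an adjoint, so \<open>\<langle>A \<phi>\<^sub>m, A \<phi>\<^sub>k\<rangle> = \<sigma>\<^sub>m\<^sup>2 \<langle>\<phi>\<^sub>m, \<phi>\<^sub>k\<rangle>\<close>; thus the \<open>\<psi>\<^sub>m\<close> are orthonormal
  and \<open>A \<phi>\<^sub>m = 0\<close> when \<open>\<sigma>\<^sub>m = 0\<close>. Since \<open>f\<^sub>i\<close> is the function of \<open>A (x)\<^sub>i\<close>, applying \<open>A\<close> to the
  expansion of \<open>(x)\<^sub>i\<close> in the basis \<open>\<phi>\<close> expands \<open>f\<^sub>i\<close> in the \<open>\<psi>\<^sub>m\<close>, and evaluation along the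
  trajectory gives the series for the velocity. Point evaluations are uniformly bounded on the
  compact image of the trajectory by the Banach--Steinhaus theorem, so integration along the
  trajectory is a bounded functional and may be applied to the same series term by term.
\<close>

section \<open>Uniform boundedness by Baire category\<close>

text \<open>The closed sets \<open>S n\<close> cover a complete space, so one of them contains a
  ball. Comparing a map at the centre with its value at a shifted point then bounds it on the
  shift.\<close>

theorem banach_steinhaus:
  fixes F :: "'i \<Rightarrow> 'a::{real_normed_vector,complete_space} \<Rightarrow> 'b::real_normed_vector"
  assumes lin: "\<And>i. i \<in> I \<Longrightarrow> bounded_linear (F i)"
    and pw: "\<And>v. bounded ((\<lambda>i. F i v) ` I)"
  shows "\<exists>C. \<forall>i\<in>I. \<forall>v. norm (F i v) \<le> C * norm v"
proof -
  define S where "S n = {v. \<forall>i\<in>I. norm (F i v) \<le> real n}" for n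
  have cl: "closed (S n)" for n
  proof -
    have "closed {v. norm (F i v) \<le> real n}" if "i \<in> I" for i
      by (intro closed_Collect_le continuous_on_norm continuous_on_const
          linear_continuous_on lin that)
    moreover have "S n = (\<Inter>i\<in>I. {v. norm (F i v) \<le> real n})"
      by (auto simp: S_def)
    ultimately show ?thesis by auto
  qed
  have cover: "\<Union> (range S) = UNIV"
  proof -
    have "\<exists>n. v \<in> S n" for v
    proof -
      obtain b where "\<And>i. i \<in> I \<Longrightarrow> norm (F i v) \<le> b"
        using pw[of v] by (auto simp: bounded_iff)
      moreover obtain n where "b \<le> real n" using real_arch_simple by blast
      ultimately show ?thesis by (force simp: S_def intro: order_trans)
    qed
    then show ?thesis by auto
  qed
  have "\<exists>n. interior (S n) \<noteq> {}"
  proof (rule ccontr)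
    assume "\<nexists>n. interior (S n) \<noteq> {}"
    then have "euclidean interior_of \<Union> (range S) = {}"
      using cl by (intro Baire_category_alt) (auto simp: completely_metrizable_space_euclidean)
    then show False by (simp add: cover)
  qed
  then obtain n w e where e: "e > 0" and ball: "ball w e \<subseteq> S n"
    by (meson ex_in_conv mem_interior)
  have "norm (F i v) \<le> (4 * real n / e) * norm v" if i: "i \<in> I" for i v
  proof (cases "v = 0")
    case True
    then show ?thesis using linear_0[OF bounded_linear.linear[OF lin[OF i]]] by simp
  next
    case False
    interpret bounded_linear "F i" by (rule lin[OF i])
    \<comment> \<open>The shift \<open>c *\<^sub>R v\<close> has length \<open>e / 2\<close>, which
      keeps the shifted point inside the open ball.\<close>
    define c where "c = e / (2 * norm v)"
    have c: "c > 0" using False e by (simp add: c_def)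
    have "w \<in> S n" "w + c *\<^sub>R v \<in> S n"
      using False e ball by (auto simp: c_def dist_norm subset_iff)
    then have "norm (F i w) \<le> n" "norm (F i (w + c *\<^sub>R v)) \<le> n"
      using i by (auto simp: S_def)
    then have "norm (F i (w + c *\<^sub>R v) - F i w) \<le> 2 * n"
      using norm_triangle_ineq4[of "F i (w + c *\<^sub>R v)" "F i w"] by linarith
    then have "c * norm (F i v) \<le> 2 * n"
      using c by (simp add: add scaleR)
    then show ?thesis
      using False e by (simp add: c_def field_simps)
  qed
  then show ?thesis by blast
qed

section \<open>Expansion in an orthonormal basis\<close>

lemma norm_orthonormal_sum:
  assumes e: "orthonormal_on I e" and F: "finite F" "F \<subseteq> I"
  shows "(norm (\<Sum>i\<in>F. a i *\<^sub>R e i))\<^sup>2 = (\<Sum>i\<in>F. (a i)\<^sup>2)"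
proof -
  have "norm (e i) = 1" if "i \<in> I" for i
    using e that by (simp add: orthonormal_on_def norm_eq_sqrt_inner)
  then show ?thesis
    using e F by (subst norm_sum_Pythagorean)
      (auto simp: pairwise_def orthogonal_def orthonormal_on_def subset_iff intro!: sum.cong)
qed

text \<open>The finite sum is the orthogonal projection of \<open>v\<close>, so the remainder is
  orthogonal to it and Pythagoras applies.\<close>

lemma norm_minus_projection_le:
  assumes e: "orthonormal_on I e" and F: "finite F" "F \<subseteq> I"
  shows "norm (v - (\<Sum>i\<in>F. (v \<bullet> e i) *\<^sub>R e i)) \<le> norm v"
proof -
  define p where "p = (\<Sum>i\<in>F. (v \<bullet> e i) *\<^sub>R e i)"
  have "v \<bullet> p = (norm p)\<^sup>2"
    unfolding p_def norm_orthonormal_sum[OF assms] by (simp add: inner_sum_right power2_eq_square)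
  then have "orthogonal (v - p) p"
    by (simp add: orthogonal_def inner_diff_left power2_norm_eq_inner)
  from norm_add_Pythagorean[OF this] have "(norm (v - p))\<^sup>2 \<le> (norm v)\<^sup>2" by simp
  then show ?thesis unfolding p_def by (rule power2_le_imp_le) simp
qed

text \<open>The projections \<open>P F\<close> eventually fix each vector of the span, and the
  remainder map does not increase norms. Density of the span carries convergence to every
  \<open>v\<close>.\<close>

lemma orthonormal_basis_has_sum:
  assumes "orthonormal_basis \<phi>"
  shows "((\<lambda>m. (v \<bullet> \<phi> m) *\<^sub>R \<phi> m) has_sum v) UNIV"
proof -
  have on: "orthonormal_on UNIV \<phi>" and dense: "closure (span (range \<phi>)) = UNIV"
    using assms by (auto simp: orthonormal_basis_def)
  define P where "P F u = (\<Sum>m\<in>F. (u \<bullet> \<phi> m) *\<^sub>R \<phi> m)" for F u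
  have P_add: "P F (u + w) = P F u + P F w" for F u w
    by (simp add: P_def inner_add_left scaleR_add_left sum.distrib)
  have P_scale: "P F (c *\<^sub>R u) = c *\<^sub>R P F u" for F c u
    by (simp add: P_def scaleR_sum_right)
  have P_span: "eventually (\<lambda>F. P F w = w) (finite_subsets_at_top UNIV)"
    if "w \<in> span (range \<phi>)" for w
    using that
  proof (induction rule: span_induct)
    case base
    show ?case
    proof (intro subspaceI CollectI)
      fix u w
      assume "u \<in> {w. eventually (\<lambda>F. P F w = w) (finite_subsets_at_top UNIV)}"
        and "w \<in> {w. eventually (\<lambda>F. P F w = w) (finite_subsets_at_top UNIV)}"
      then have "eventually (\<lambda>F. P F u = u \<and> P F w = w) (finite_subsets_at_top UNIV)"
        by (simp add: eventually_conj_iff)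
      then show "eventually (\<lambda>F. P F (u + w) = u + w) (finite_subsets_at_top UNIV)"
        by eventually_elim (simp add: P_add)
    next
      fix c u
      assume "u \<in> {w. eventually (\<lambda>F. P F w = w) (finite_subsets_at_top UNIV)}"
      then have "eventually (\<lambda>F. P F u = u) (finite_subsets_at_top UNIV)" by simp
      then show "eventually (\<lambda>F. P F (c *\<^sub>R u) = c *\<^sub>R u) (finite_subsets_at_top UNIV)"
        by eventually_elim (simp add: P_scale)
    qed (simp add: P_def)
  next
    case (step w)
    then obtain k where w: "w = \<phi> k" by auto
    have "P F w = w" if "finite F" "{k} \<subseteq> F" for F
    proof -
      have "P F w = (\<Sum>m\<in>F. if k = m then \<phi> m else 0)"
        unfolding P_def w using on by (intro sum.cong) (auto simp: orthonormal_on_def)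
      then show ?thesis using that by (simp add: w)
    qed
    then show ?case
      by (auto simp: eventually_finite_subsets_at_top intro!: exI[of _ "{k}"])
  qed
  have "((\<lambda>F. P F v) \<longlongrightarrow> v) (finite_subsets_at_top UNIV)"
  proof (rule tendstoI)
    fix d :: real
    assume "d > 0"
    then obtain w where w: "w \<in> span (range \<phi>)" "dist w v < d"
      using dense by (metis UNIV_I closure_approachable)
    \<comment> \<open>The norm estimate needs a finite index set, so finiteness of \<open>F\<close>
      enters as a further eventual property.\<close>
    have "eventually finite (finite_subsets_at_top UNIV)"
      by (rule eventually_finite_subsets_at_top_weakI)
    with P_span[OF w(1)]
    show "eventually (\<lambda>F. dist (P F v) v < d) (finite_subsets_at_top UNIV)"
    proof eventually_elim
      case (elim F)
      have "v - P F v = (v - w) - P F (v - w)"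
        using elim(1) P_add[of F "v - w" w] by simp
      also have "norm \<dots> \<le> norm (v - w)"
        unfolding P_def by (rule norm_minus_projection_le[OF on elim(2) subset_UNIV])
      finally have "norm (v - P F v) \<le> norm (v - w)" .
      then show ?case using w(2) by (simp add: dist_norm norm_minus_commute)
    qed
  qed
  then show ?thesis by (simp add: has_sum_def P_def)
qed

section \<open>Square-summable coefficients and the adjoint\<close>

text \<open>By Pythagoras, the squared norm of a block of terms is the matching block of the
  convergent series of squares; this is the Riesz-Fischer argument.\<close>

lemma Cauchy_orthonormal_partial_sums:
  fixes e :: "nat \<Rightarrow> 'a::real_inner"
  assumes e: "orthonormal_on UNIV e" and a: "summable (\<lambda>n. (a n)\<^sup>2)"
  shows "Cauchy (\<lambda>n. \<Sum>i<n. a i *\<^sub>R e i)"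
proof (rule CauchyI')
  fix d :: real
  assume d: "d > 0"
  then obtain N where N: "\<And>m n. m \<ge> N \<Longrightarrow> norm (\<Sum>i\<in>{m..<n}. (a i)\<^sup>2) < d\<^sup>2"
    using a by (metis summable_Cauchy zero_less_power)
  have "dist (\<Sum>i<m. a i *\<^sub>R e i) (\<Sum>i<n. a i *\<^sub>R e i) < d" if "m \<ge> N" "n > m" for m n
  proof -
    have "(\<Sum>i<n. a i *\<^sub>R e i) - (\<Sum>i<m. a i *\<^sub>R e i) = (\<Sum>i\<in>{m..<n}. a i *\<^sub>R e i)"
      using that sum_diff_nat_ivl[of 0 m n "\<lambda>i. a i *\<^sub>R e i"] by (simp add: atLeast0LessThan)
    moreover have "(norm (\<Sum>i\<in>{m..<n}. a i *\<^sub>R e i))\<^sup>2 < d\<^sup>2"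
      using norm_orthonormal_sum[OF e, of "{m..<n}" a] N[OF that(1), of n] by (simp add: sum_nonneg)
    ultimately have "norm ((\<Sum>i<n. a i *\<^sub>R e i) - (\<Sum>i<m. a i *\<^sub>R e i)) < d"
      using d by (metis less_imp_le power2_less_imp_less)
    then show ?thesis by (simp add: dist_norm norm_minus_commute)
  qed
  then show "\<exists>M. \<forall>m\<ge>M. \<forall>n>m. dist (\<Sum>i<m. a i *\<^sub>R e i) (\<Sum>i<n. a i *\<^sub>R e i) < d"
    by blast
qed

text \<open>In the library \<^const>\<open>adjoint\<close> is a Hilbert choice that is only known to exist in finite
  dimension; an orthonormal basis of the domain lets one write the adjoint as a series.\<close>

lemma adjoint_inner:
  fixes A :: "'h::{real_inner,complete_space} \<Rightarrow> 'k::real_inner" and \<phi> :: "nat \<Rightarrow> 'h"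
  assumes A: "bounded_linear A" and \<phi>: "orthonormal_basis \<phi>"
  shows "A u \<bullet> y = u \<bullet> adjoint A y"
proof -
  interpret A: bounded_linear A by fact
  have on: "orthonormal_on UNIV \<phi>" using \<phi> by (simp add: orthonormal_basis_def)
  have "\<exists>z. \<forall>u. A u \<bullet> y = u \<bullet> z" for y
  proof -
    obtain K where K: "\<And>u. norm (A u) \<le> norm u * K" "K > 0" using A.pos_bounded by blast
    \<comment> \<open>These are the coefficients that the representing vector \<open>z\<close> must
      have along \<open>\<phi> m\<close>.\<close>
    define a where "a m = A (\<phi> m) \<bullet> y" for m
    have bound: "(\<Sum>m<n. (a m)\<^sup>2) \<le> (K * norm y)\<^sup>2" for n
    proof -
      \<comment> \<open>Testing \<open>A\<close> on the truncated candidate gives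
        \<open>(norm v)\<^sup>2 = A v \<bullet> y\<close>. Cancelling one factor
        \<open>norm v\<close> leaves a bound independent of \<open>n\<close>.\<close>
      define v where "v = (\<Sum>m<n. a m *\<^sub>R \<phi> m)"
      have nv: "(norm v)\<^sup>2 = (\<Sum>m<n. (a m)\<^sup>2)"
        unfolding v_def by (rule norm_orthonormal_sum[OF on]) auto
      also have "\<dots> = A v \<bullet> y"
        by (simp add: v_def A.sum A.scaleR inner_sum_left a_def power2_eq_square)
      also have "\<dots> \<le> norm (A v) * norm y" by (rule norm_cauchy_schwarz)
      also have "\<dots> \<le> norm v * (K * norm y)"
        using mult_right_mono[OF K(1)[of v], of "norm y"] by (simp add: mult_ac)
      finally have "norm v \<le> K * norm y"
        using K(2) by (cases "v = 0") (auto simp: power2_eq_square)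
      then show ?thesis by (simp flip: nv add: power_mono)
    qed
    have "summable (\<lambda>m. (a m)\<^sup>2)"
      by (rule summableI_nonneg_bounded[OF _ bound]) simp
    then obtain z where "(\<lambda>m. a m *\<^sub>R \<phi> m) sums z"
      using Cauchy_orthonormal_partial_sums[OF on] Cauchy_convergent
      by (metis convergent_def sums_def)
    then have "(\<lambda>m. u \<bullet> (a m *\<^sub>R \<phi> m)) sums (u \<bullet> z)" for u
      by (rule bounded_linear.sums[OF bounded_linear_inner_right])
    moreover have "(\<lambda>m. u \<bullet> (a m *\<^sub>R \<phi> m)) sums (A u \<bullet> y)" for u
    proof -
      have "bounded_linear (\<lambda>w. A w \<bullet> y)"
        using bounded_linear_compose[OF bounded_linear_inner_left A] .
      from has_sum_bounded_linear[OF this orthonormal_basis_has_sum[OF \<phi>, of u]]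
      have "(\<lambda>m. A ((u \<bullet> \<phi> m) *\<^sub>R \<phi> m) \<bullet> y) sums (A u \<bullet> y)" by (rule has_sum_imp_sums)
      then show ?thesis by (simp add: A.scaleR a_def mult.commute)
    qed
    ultimately show ?thesis using sums_unique2 by blast
  qed
  then obtain g where g: "\<And>u y. A u \<bullet> y = u \<bullet> g y" by metis
  \<comment> \<open>Uniqueness identifies the constructed map with the one chosen by
    \<open>adjoint\<close>.\<close>
  then have "adjoint A = g" by (intro adjoint_unique) simp
  then show ?thesis by (simp add: g)
qed

lemma compact_operator_imp_bounded_linear:
  assumes "compact_operator A"
  shows "bounded_linear A"
proof -
  have lin: "linear A" and "compact (closure (A ` cball 0 1))"
    using assms by (auto simp: compact_operator_def)
  then have "bounded (A ` cball 0 1)"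
    by (meson bounded_subset closure_subset compact_imp_bounded)
  then obtain K where K: "\<And>u. norm u \<le> 1 \<Longrightarrow> norm (A u) \<le> K"
    by (fastforce simp: bounded_iff)
  have "norm (A u) \<le> norm u * K" for u
  proof (cases "u = 0")
    case True
    then show ?thesis by (simp add: linear_0[OF lin])
  next
    case False
    have "norm (A (u /\<^sub>R norm u)) \<le> K" by (rule K) (simp add: False)
    then show ?thesis using False by (simp add: linear_scale[OF lin] field_simps)
  qed
  then show ?thesis
    using lin by (auto simp: bounded_linear_def bounded_linear_axioms_def)
qed

lemma has_sum_vec:
  fixes f :: "'a \<Rightarrow> real ^ 'n"
  assumes "\<And>i. ((\<lambda>m. f m $ i) has_sum (s $ i)) S"
  shows "(f has_sum s) S"
  unfolding has_sum_def
proof (rule vec_tendstoI)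
  fix i
  show "((\<lambda>F. sum f F $ i) \<longlongrightarrow> s $ i) (finite_subsets_at_top S)"
    using assms[of i] by (simp add: has_sum_def sum_component)
qed

section \<open>Coordinate functions and integration along curves\<close>

lemma continuously_differentiable_imp_continuous_on:
  assumes "continuously_differentiable g"
  shows "continuous_on S g"
proof -
  obtain G where "\<And>x. GDERIV g x :> G x"
    using assms by (auto simp: continuously_differentiable_def)
  then show ?thesis
    by (meson GDERIV_DERIV_compose continuous_at_imp_continuous_on gderiv_def
        has_derivative_continuous)
qed

text \<open>The partial derivatives of a coordinate function are Kronecker deltas, so one summand
  survives. This makes the components of \<open>f\<close> functions in the range of the
  operator.\<close>

lemma liouville_coord: "liouville f (\<lambda>y. y $ i) x = f x $ i"
proof -
  have "partial_deriv j (\<lambda>y. y $ i) x = (if j = i then 1 else 0)" for j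
  proof -
    have "((\<lambda>s. x $ i + s * axis j 1 $ i) has_real_derivative axis j 1 $ i) (at 0)"
      by (auto intro!: derivative_eq_intros)
    then show ?thesis
      by (auto simp: partial_deriv_def axis_def dest: DERIV_imp_deriv)
  qed
  then show ?thesis by (simp add: liouville_def if_distrib[of "\<lambda>c. c * _"] cong: if_cong)
qed

text \<open>Each function is bounded along the compact curve, so uniform boundedness yields one
  constant \<open>C\<close> for all evaluations there; integrating costs a factor
  \<open>b - a\<close>.\<close>

lemma bounded_linear_integral_eval:
  fixes ev :: "'k::{real_inner,complete_space} \<Rightarrow> real ^ 'n \<Rightarrow> real"
    and x :: "real \<Rightarrow> real ^ 'n"
  assumes ev: "rkhs ev" and cont: "\<And>g. continuous_on UNIV (ev g)"
    and x: "continuous_on {a..b} x"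
  shows "bounded_linear (\<lambda>g. integral {a..b} (\<lambda>\<tau>. ev g (x \<tau>)))"
proof -
  have lin: "bounded_linear (\<lambda>g. ev g y)" for y using ev by (simp add: rkhs_def)
  have cont_x: "continuous_on {a..b} (\<lambda>\<tau>. ev g (x \<tau>))" for g
    by (rule continuous_on_compose2[OF cont x]) auto
  have int: "(\<lambda>\<tau>. ev g (x \<tau>)) integrable_on {a..b}" for g
    by (rule integrable_continuous_real[OF cont_x])
  have "bounded ((\<lambda>\<tau>. ev g (x \<tau>)) ` {a..b})" for g
    by (intro compact_imp_bounded compact_continuous_image cont_x compact_Icc)
  from banach_steinhaus[of "{a..b}" "\<lambda>\<tau> g. ev g (x \<tau>)", OF lin this]
  obtain C where C: "\<And>\<tau> g. \<tau> \<in> {a..b} \<Longrightarrow> \<bar>ev g (x \<tau>)\<bar> \<le> C * norm g"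
    unfolding real_norm_def by blast
  show ?thesis
  proof (cases "a \<le> b")
    \<comment> \<open>The interval is empty, so the integral is 0 for every
      \<open>g\<close>.\<close>
    case False
    then show ?thesis by (simp add: bounded_linear_zero)
  next
    case True
    show ?thesis
    proof (rule bounded_linear_intro)
      fix g h
      show "integral {a..b} (\<lambda>\<tau>. ev (g + h) (x \<tau>))
          = integral {a..b} (\<lambda>\<tau>. ev g (x \<tau>)) + integral {a..b} (\<lambda>\<tau>. ev h (x \<tau>))"
        by (simp add: linear_add[OF bounded_linear.linear[OF lin]] integral_add[OF int int])
    next
      fix r g
      show "integral {a..b} (\<lambda>\<tau>. ev (r *\<^sub>R g) (x \<tau>)) = r *\<^sub>R integral {a..b} (\<lambda>\<tau>. ev g (x \<tau>))"
        by (simp add: linear_scale[OF bounded_linear.linear[OF lin]])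
    next
      fix g
      show "norm (integral {a..b} (\<lambda>\<tau>. ev g (x \<tau>))) \<le> norm g * (C * (b - a))"
        using integral_bound[OF True cont_x, of g "C * norm g"] C by (simp add: mult_ac)
    qed
  qed
qed

section \<open>Singular value expansion along trajectories\<close>

text \<open>The sums over nonzero \<open>\<sigma> m\<close> are unconditional, which avoids
  enumerating an index set that may be finite. Well-definedness of the operator is expressed by a
  map \<open>A\<close> whose values have the Liouville images as their functions.\<close>

theorem mainTheorem3:
  fixes evH :: "'h::{real_inner,complete_space} \<Rightarrow> real ^ 'n \<Rightarrow> real"
    and evK :: "'k::{real_inner,complete_space} \<Rightarrow> real ^ 'n \<Rightarrow> real"
    and f :: "real ^ 'n \<Rightarrow> real ^ 'n"
    and A :: "'h \<Rightarrow> 'k"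
    and \<phi> :: "nat \<Rightarrow> 'h"
    and \<psi> :: "nat \<Rightarrow> 'k"
    and \<sigma> :: "nat \<Rightarrow> real"
    and coord :: "'n \<Rightarrow> 'h"
    and \<xi> :: "nat \<Rightarrow> real ^ 'n"
  assumes "rkhs evH" and "\<And>g. continuously_differentiable (evH g)"
    and "rkhs evK" and "\<And>g. continuously_differentiable (evK g)"
    and "\<And>g. evK (A g) = liouville f (evH g)"
    and "compact_operator A"
    and "orthonormal_basis \<phi>"
    and "\<And>m. adjoint A (A (\<phi> m)) = (\<sigma> m)\<^sup>2 *\<^sub>R \<phi> m"
    and "\<And>m. \<sigma> m \<ge> 0"
    and "\<And>m. \<sigma> m \<noteq> 0 \<Longrightarrow> \<psi> m = A (\<phi> m) /\<^sub>R \<sigma> m"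
    and "\<And>i. evH (coord i) = (\<lambda>x. x $ i)"
    and "\<And>m i. \<xi> m $ i = coord i \<bullet> \<phi> m"
  shows "orthonormal_on {m. \<sigma> m \<noteq> 0} \<psi> \<and>
    (\<forall>i x. (\<lambda>m. \<xi> m $ i * evH (\<phi> m) x) sums (x $ i)) \<and>
    (\<forall>T x. trajectory f T x \<longrightarrow> (\<forall>t\<in>{0..T}.
       ((\<lambda>m. (\<sigma> m * evK (\<psi> m) (x t)) *\<^sub>R \<xi> m)
          has_sum vector_derivative x (at t within {0..T})) {m. \<sigma> m \<noteq> 0} \<and>
       ((\<lambda>m. (\<sigma> m * integral {0..t} (\<lambda>\<tau>. evK (\<psi> m) (x \<tau>))) *\<^sub>R \<xi> m)
          has_sum (x t - x 0)) {m. \<sigma> m \<noteq> 0}))"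
proof -
  note evH = assms(1) and evK = assms(3) and C1K = assms(4) and evK_A = assms(5)
    and basis = assms(7) and eigen = assms(8) and \<psi> = assms(10) and coord = assms(11)
    and \<xi> = assms(12)
  have A: "bounded_linear A" by (rule compact_operator_imp_bounded_linear[OF assms(6)])
  interpret A: bounded_linear A by (rule A)
  have evH_lin: "bounded_linear (\<lambda>g. evH g x)" for x using evH by (simp add: rkhs_def)
  have evK_lin: "bounded_linear (\<lambda>g. evK g x)" for x using evK by (simp add: rkhs_def)
  have evK_cont: "continuous_on UNIV (evK g)" for g
    by (rule continuously_differentiable_imp_continuous_on[OF C1K])
  have \<phi>_inner: "\<phi> i \<bullet> \<phi> j = (if i = j then 1 else 0)" for i j
    using basis by (simp add: orthonormal_basis_def orthonormal_on_def)
  have A_inner: "A (\<phi> i) \<bullet> A (\<phi> j) = (if i = j then (\<sigma> j)\<^sup>2 else 0)" for i j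
    by (simp add: adjoint_inner[OF A basis] eigen \<phi>_inner)
  have A_zero: "A (\<phi> m) = 0" if "\<sigma> m = 0" for m
    using A_inner[of m m] that by simp
  have A_\<phi>: "A (\<phi> m) = \<sigma> m *\<^sub>R \<psi> m" if "\<sigma> m \<noteq> 0" for m
    using that by (simp add: \<psi>)
  have on: "orthonormal_on {m. \<sigma> m \<noteq> 0} \<psi>"
  proof -
    have "inverse s * (inverse s * s\<^sup>2) = 1" if "s \<noteq> 0" for s :: real
      using that by (simp add: power2_eq_square flip: mult.assoc)
    then show ?thesis by (simp add: orthonormal_on_def \<psi> A_inner)
  qed
  have coord_sums: "(\<lambda>m. \<xi> m $ i * evH (\<phi> m) x) sums (x $ i)" for i x
    using has_sum_imp_sums[OF has_sum_bounded_linear[OF evH_lin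
          orthonormal_basis_has_sum[OF basis, of "coord i"]], of x]
    by (simp add: linear_scale[OF bounded_linear.linear[OF evH_lin]] coord \<xi>)
  have A_coord: "((\<lambda>m. (\<xi> m $ i * \<sigma> m) *\<^sub>R \<psi> m) has_sum A (coord i)) {m. \<sigma> m \<noteq> 0}" for i
  proof -
    have "((\<lambda>m. A ((coord i \<bullet> \<phi> m) *\<^sub>R \<phi> m)) has_sum A (coord i)) UNIV"
      by (rule has_sum_bounded_linear[OF A orthonormal_basis_has_sum[OF basis]])
    \<comment> \<open>Terms with \<open>\<sigma> m = 0\<close> vanish, so the index set shrinks from
      all of \<open>nat\<close>.\<close>
    then show ?thesis
      by (rule has_sum_cong_neutral[THEN iffD1, rotated 3]) (auto simp: A.scaleR A_zero A_\<phi> \<xi>)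
  qed
  \<comment> \<open>Both series are instances: \<open>L\<close> is evaluation at \<open>x t\<close>
    for the velocity, and integration along the trajectory for the displacement.\<close>
  have functional_has_sum: "((\<lambda>m. (\<sigma> m * L (\<psi> m)) *\<^sub>R \<xi> m) has_sum s) {m. \<sigma> m \<noteq> 0}"
    if L: "bounded_linear L" and s: "\<And>i. L (A (coord i)) = s $ i" for L and s :: "real ^ 'n"
  proof (rule has_sum_vec)
    fix i
    show "((\<lambda>m. ((\<sigma> m * L (\<psi> m)) *\<^sub>R \<xi> m) $ i) has_sum s $ i) {m. \<sigma> m \<noteq> 0}"
      using has_sum_bounded_linear[OF L A_coord[of i]]
      by (simp add: linear_scale[OF bounded_linear.linear[OF L]] s mult_ac)
  qed
  have f_eq: "evK (A (coord i)) y = f y $ i" for i y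
    by (simp add: evK_A coord liouville_coord)
  have "((\<lambda>m. (\<sigma> m * evK (\<psi> m) (x t)) *\<^sub>R \<xi> m)
          has_sum vector_derivative x (at t within {0..T})) {m. \<sigma> m \<noteq> 0} \<and>
       ((\<lambda>m. (\<sigma> m * integral {0..t} (\<lambda>\<tau>. evK (\<psi> m) (x \<tau>))) *\<^sub>R \<xi> m)
          has_sum (x t - x 0)) {m. \<sigma> m \<noteq> 0}"
    if traj: "trajectory f T x" and t: "t \<in> {0..T}" for T x t
  proof
    have T: "0 < T"
      and x: "\<And>s. s \<in> {0..T} \<Longrightarrow> (x has_vector_derivative f (x s)) (at s within {0..T})"
      using traj by (auto simp: trajectory_def)
    show "((\<lambda>m. (\<sigma> m * evK (\<psi> m) (x t)) *\<^sub>R \<xi> m)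
          has_sum vector_derivative x (at t within {0..T})) {m. \<sigma> m \<noteq> 0}"
      \<comment> \<open>Since \<open>0 < T\<close>, the derivative within the interval is unique,
        also at its end points, and equals \<open>f (x t)\<close>.\<close>
      unfolding vector_derivative_within_closed_interval[OF T t x[OF t]]
      by (rule functional_has_sum[OF evK_lin f_eq])
    have x': "(x has_vector_derivative f (x s)) (at s within {0..t})" if "s \<in> {0..t}" for s
      using that t by (intro has_vector_derivative_within_subset[OF x]) auto
    have "continuous_on {0..t} x"
      using x' has_vector_derivative_continuous by (blast intro: continuous_on_eq_continuous_within[THEN iffD2])
    then have L: "bounded_linear (\<lambda>g. integral {0..t} (\<lambda>\<tau>. evK g (x \<tau>)))"
      by (rule bounded_linear_integral_eval[OF evK evK_cont])
    \<comment> \<open>For the gauge integral, a derivative at every point suffices; integrability of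
      \<open>f\<close> along \<open>x\<close> is part of the conclusion.\<close>
    have "((\<lambda>s. f (x s)) has_integral (x t - x 0)) {0..t}"
      using t x' by (intro fundamental_theorem_of_calculus) auto
    from has_integral_linear[OF this bounded_linear_vec_nth]
    have "((\<lambda>s. f (x s) $ i) has_integral (x t - x 0) $ i) {0..t}" for i
      by (simp only: o_def)
    then have "integral {0..t} (\<lambda>s. evK (A (coord i)) (x s)) = (x t - x 0) $ i" for i
      by (simp only: f_eq integral_unique)
    then show "((\<lambda>m. (\<sigma> m * integral {0..t} (\<lambda>\<tau>. evK (\<psi> m) (x \<tau>))) *\<^sub>R \<xi> m)
          has_sum (x t - x 0)) {m. \<sigma> m \<noteq> 0}"
      by (rule functional_has_sum[OF L])
  qed
  with on coord_sums show ?thesis by blast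
qed

end
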